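(* Let $k$ be a commutative ring with unit, $\mathcal{C}$ a finite poset and $\mathbb{A}$ a presheaf of (associative unital) $k$-algebras over $\mathcal{C}$. Then 1) $\mathbb{A}!$ is clean (respectively nil-clean) if and only if $\mathbb{A}^i$ is clean (respectively nil-clean) for all $i\in\mathcal{C}$. 2) $\mathbb{A}!$ is exchange if and only if $\mathbb{A}^i$ is exchange for all $i\in\mathcal{C}$.
   Context: The poset $\mathcal{C}$ is viewed as a category with a unique map $i\to j$ for each $i\le j$. A presheaf of $k$-algebras over $\mathcal{C}$ is a functor $\mathbb{A}:\mathcal{C}^{op}\to k\text{-}\mathbf{alg}$; write $\mathbb{A}^i=\mathbb{A}(i)$ and, for $i\le j$, let $\varphi^{ij}:\mathbb{A}^j\to\mathbb{A}^i$ be the induced $k$-algebra map. The algebra $\mathbb{A}!$ consists of the $\mathcal{C}\times\mathcal{C}$ matrices $(a_{ij})$ with $a_{ij}\in\mathbb{A}^i$ if $i\le j$ and $a_{ij}=0$ otherwise. Addition is componentwise, and the multiplication $(a_{ij})(b_{ij})=(c_{ij})$ is given by $c_{hj}=\sum_{h\le i\le j}a_{hi}\,\varphi^{hi}(b_{ij})$ for $h\le j$ (and $c_{hj}=0$ otherwise). A unital ring $R$ is nil-clean if every $a\in R$ can be written $a=e+n$ with $e$ idempotent and $n$ nilpotent in $R$. It is clean if every $a\in R$ can be written $a=e+u$ with $e$ idempotent and $u$ invertible in $R$. It is exchange if for every $a\in R$ there is an idempotent $e\in R$ with $e\in aR$ and $1-e\in(1-a)R$. *)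

theory Defs
  imports "HOL-Algebra.RingHom" "HOL-Algebra.Module"
begin

section \<open>Algebras and presheaves of algebras\<close>

text \<open>
  The locale \<^locale>\<open>algebra\<close> of the library requires the algebra itself to be commutative.
\<close>

locale assoc_algebra = module R M + ring M
  for R :: "('k, 'l) ring_scheme" (structure) and M :: "('k, 'a, 'm) module_scheme" (structure) +
  assumes smult_mult_left:
      "\<lbrakk>c \<in> carrier R; x \<in> carrier M; y \<in> carrier M\<rbrakk>
        \<Longrightarrow> (c \<odot>\<^bsub>M\<^esub> x) \<otimes>\<^bsub>M\<^esub> y = c \<odot>\<^bsub>M\<^esub> (x \<otimes>\<^bsub>M\<^esub> y)"
    and smult_mult_right:
      "\<lbrakk>c \<in> carrier R; x \<in> carrier M; y \<in> carrier M\<rbrakk>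
        \<Longrightarrow> x \<otimes>\<^bsub>M\<^esub> (c \<odot>\<^bsub>M\<^esub> y) = c \<odot>\<^bsub>M\<^esub> (x \<otimes>\<^bsub>M\<^esub> y)"

definition algebra_hom ::
    "[('k, 'l) ring_scheme, ('k, 'a, 'm) module_scheme, ('k, 'b, 'n) module_scheme] \<Rightarrow> ('a \<Rightarrow> 'b) set"
  where "algebra_hom k M N =
    {f \<in> ring_hom M N. \<forall>c\<in>carrier k. \<forall>x\<in>carrier M. f (c \<odot>\<^bsub>M\<^esub> x) = c \<odot>\<^bsub>N\<^esub> f x}"

text \<open>
  The poset is the set \<open>C\<close> with the order \<open>i \<le> j\<close> given by \<open>(i, j) \<in> P\<close>. The map
  \<open>\<phi> i j\<close> goes from \<open>A j\<close> to \<open>A i\<close>. All \<open>A i\<close> have their carrier in one type, which is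
  no restriction, as any family of sets embeds into its disjoint union.
\<close>

locale algebra_presheaf = cring k
  for k :: "('k, 'l) ring_scheme" and C :: "'c set" and P :: "('c \<times> 'c) set"
    and A :: "'c \<Rightarrow> ('k, 'a, 'm) module_scheme" and \<phi> :: "'c \<Rightarrow> 'c \<Rightarrow> 'a \<Rightarrow> 'a" +
  assumes poset: "partial_order_on C P"
    and algebra: "i \<in> C \<Longrightarrow> assoc_algebra k (A i)"
    and hom: "(i, j) \<in> P \<Longrightarrow> \<phi> i j \<in> algebra_hom k (A j) (A i)"
    and map_id: "\<lbrakk>i \<in> C; x \<in> carrier (A i)\<rbrakk> \<Longrightarrow> \<phi> i i x = x"
    and map_comp: "\<lbrakk>(h, i) \<in> P; (i, j) \<in> P; x \<in> carrier (A j)\<rbrakk> \<Longrightarrow> \<phi> h i (\<phi> i j x) = \<phi> h j x"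


section \<open>The matrix algebra of a presheaf\<close>

definition matrix_algebra ::
    "['c set, ('c \<times> 'c) set, 'c \<Rightarrow> ('k, 'a, 'm) module_scheme, 'c \<Rightarrow> 'c \<Rightarrow> 'a \<Rightarrow> 'a]
      \<Rightarrow> ('k, 'c \<times> 'c \<Rightarrow> 'a) module"
  where "matrix_algebra C P A \<phi> =
    \<lparr>carrier = (\<Pi>\<^sub>E (i, j) \<in> C \<times> C. if (i, j) \<in> P then carrier (A i) else {\<zero>\<^bsub>A i\<^esub>}),
     mult = (\<lambda>a b. \<lambda>(h, j) \<in> C \<times> C.
       if (h, j) \<in> P
       then \<Oplus>\<^bsub>A h\<^esub> i \<in> {i \<in> C. (h, i) \<in> P \<and> (i, j) \<in> P}. a (h, i) \<otimes>\<^bsub>A h\<^esub> \<phi> h i (b (i, j))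
       else \<zero>\<^bsub>A h\<^esub>),
     one = (\<lambda>(i, j) \<in> C \<times> C. if i = j then \<one>\<^bsub>A i\<^esub> else \<zero>\<^bsub>A i\<^esub>),
     zero = (\<lambda>(i, j) \<in> C \<times> C. \<zero>\<^bsub>A i\<^esub>),
     add = (\<lambda>a b. \<lambda>(i, j) \<in> C \<times> C. a (i, j) \<oplus>\<^bsub>A i\<^esub> b (i, j)),
     smult = (\<lambda>c a. \<lambda>(i, j) \<in> C \<times> C. c \<odot>\<^bsub>A i\<^esub> a (i, j))\<rparr>"


lemma additive_finsum:
  assumes "abelian_monoid G" "abelian_monoid H"
    and "\<And>x. x \<in> carrier G \<Longrightarrow> f x \<in> carrier H" "f \<zero>\<^bsub>G\<^esub> = \<zero>\<^bsub>H\<^esub>"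
    and "\<And>x y. x \<in> carrier G \<Longrightarrow> y \<in> carrier G \<Longrightarrow> f (x \<oplus>\<^bsub>G\<^esub> y) = f x \<oplus>\<^bsub>H\<^esub> f y"
    and "finite S" "g \<in> S \<rightarrow> carrier G"
  shows "f (finsum G g S) = (\<Oplus>\<^bsub>H\<^esub> s \<in> S. f (g s))"
proof -
  interpret G: abelian_monoid G by fact
  interpret H: abelian_monoid H by fact
  show ?thesis using assms(6,7)
  proof (induction S rule: finite_induct)
    case empty
    then show ?case by (simp add: assms)
  next
    case (insert x S)
    then show ?case
      by (subst G.finsum_insert; (subst H.finsum_insert)?) (auto simp: assms Pi_iff)
  qed
qed

lemma finsum_swap:
  assumes "abelian_monoid G" "finite S" "finite T"
    and "\<And>s t. s \<in> S \<Longrightarrow> t \<in> T \<Longrightarrow> g s t \<in> carrier G"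
  shows "(\<Oplus>\<^bsub>G\<^esub> s \<in> S. \<Oplus>\<^bsub>G\<^esub> t \<in> T. g s t) = (\<Oplus>\<^bsub>G\<^esub> t \<in> T. \<Oplus>\<^bsub>G\<^esub> s \<in> S. g s t)"
proof -
  interpret G: abelian_monoid G by fact
  show ?thesis using assms(2,4)
  proof (induction S rule: finite_induct)
    case empty
    then show ?case by simp
  next
    case (insert x S)
    have "(\<Oplus>\<^bsub>G\<^esub> t \<in> T. \<Oplus>\<^bsub>G\<^esub> s \<in> insert x S. g s t)
        = (\<Oplus>\<^bsub>G\<^esub> t \<in> T. g x t \<oplus>\<^bsub>G\<^esub> (\<Oplus>\<^bsub>G\<^esub> s \<in> S. g s t))"
      using insert by (intro G.finsum_cong') (auto simp: Pi_iff)
    also have "\<dots> = (\<Oplus>\<^bsub>G\<^esub> t \<in> T. g x t) \<oplus>\<^bsub>G\<^esub> (\<Oplus>\<^bsub>G\<^esub> t \<in> T. \<Oplus>\<^bsub>G\<^esub> s \<in> S. g s t)"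
      using insert by (intro G.finsum_addf) (auto simp: Pi_iff)
    finally show ?case
      using insert by (subst G.finsum_insert) (auto simp: Pi_iff)
  qed
qed

lemma matrix_algebra_eqI:
  assumes "a \<in> extensional (C \<times> C)" "b \<in> extensional (C \<times> C)"
    and "\<And>i j. i \<in> C \<Longrightarrow> j \<in> C \<Longrightarrow> a (i, j) = b (i, j)"
  shows "a = b"
  using assms by (auto intro: extensionalityI[of a "C \<times> C" b])

context algebra_presheaf
begin

abbreviation M where "M \<equiv> matrix_algebra C P A \<phi>"

lemma P_refl: "i \<in> C \<Longrightarrow> (i, i) \<in> P"
  and P_trans: "(h, i) \<in> P \<Longrightarrow> (i, j) \<in> P \<Longrightarrow> (h, j) \<in> P"
  and P_antisym: "(i, j) \<in> P \<Longrightarrow> (j, i) \<in> P \<Longrightarrow> i = j"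
  and P_in: "(i, j) \<in> P \<Longrightarrow> i \<in> C" "(i, j) \<in> P \<Longrightarrow> j \<in> C"
  using partial_order_onD[OF poset]
  by (auto dest: refl_onD transD antisymD)

lemma ring_A: "i \<in> C \<Longrightarrow> ring (A i)"
  using algebra by (simp add: assoc_algebra_def)

lemma module_A: "i \<in> C \<Longrightarrow> module k (A i)"
  using algebra by (simp add: assoc_algebra_def)

lemma phi_closed: "(i, j) \<in> P \<Longrightarrow> x \<in> carrier (A j) \<Longrightarrow> \<phi> i j x \<in> carrier (A i)"
  and phi_mult: "(i, j) \<in> P \<Longrightarrow> x \<in> carrier (A j) \<Longrightarrow> y \<in> carrier (A j) \<Longrightarrow>
      \<phi> i j (x \<otimes>\<^bsub>A j\<^esub> y) = \<phi> i j x \<otimes>\<^bsub>A i\<^esub> \<phi> i j y"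
  and phi_add: "(i, j) \<in> P \<Longrightarrow> x \<in> carrier (A j) \<Longrightarrow> y \<in> carrier (A j) \<Longrightarrow>
      \<phi> i j (x \<oplus>\<^bsub>A j\<^esub> y) = \<phi> i j x \<oplus>\<^bsub>A i\<^esub> \<phi> i j y"
  and phi_one: "(i, j) \<in> P \<Longrightarrow> \<phi> i j \<one>\<^bsub>A j\<^esub> = \<one>\<^bsub>A i\<^esub>"
  and phi_smult: "(i, j) \<in> P \<Longrightarrow> c \<in> carrier k \<Longrightarrow> x \<in> carrier (A j) \<Longrightarrow>
      \<phi> i j (c \<odot>\<^bsub>A j\<^esub> x) = c \<odot>\<^bsub>A i\<^esub> \<phi> i j x"
  using hom[of i j] by (auto simp: algebra_hom_def ring_hom_def)

lemma phi_hom: "(i, j) \<in> P \<Longrightarrow> ring_hom_ring (A j) (A i) (\<phi> i j)"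
  using hom[of i j] ring_A P_in
  by (auto simp: algebra_hom_def intro: ring_hom_ringI2)

lemma phi_zero: "(i, j) \<in> P \<Longrightarrow> \<phi> i j \<zero>\<^bsub>A j\<^esub> = \<zero>\<^bsub>A i\<^esub>"
  using phi_hom[THEN ring_hom_ring.homh, THEN ring_hom_zero] ring_A P_in by blast

lemma carrier_M: "a \<in> carrier M \<longleftrightarrow> a \<in> extensional (C \<times> C) \<and>
    (\<forall>i\<in>C. \<forall>j\<in>C. if (i, j) \<in> P then a (i, j) \<in> carrier (A i) else a (i, j) = \<zero>\<^bsub>A i\<^esub>)"
  unfolding matrix_algebra_def by (auto simp: PiE_iff split: if_splits)

lemma M_entry: "a \<in> carrier M \<Longrightarrow> i \<in> C \<Longrightarrow> j \<in> C \<Longrightarrow> a (i, j) \<in> carrier (A i)"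
  using ring_A[of i] by (cases "(i, j) \<in> P") (auto simp: carrier_M ring.ring_simprules)

lemma M_zero_entry: "a \<in> carrier M \<Longrightarrow> i \<in> C \<Longrightarrow> j \<in> C \<Longrightarrow> (i, j) \<notin> P \<Longrightarrow> a (i, j) = \<zero>\<^bsub>A i\<^esub>"
  by (auto simp: carrier_M)

lemma M_apply:
  assumes "h \<in> C" "j \<in> C"
  shows "(a \<oplus>\<^bsub>M\<^esub> b) (h, j) = a (h, j) \<oplus>\<^bsub>A h\<^esub> b (h, j)"
    and "\<zero>\<^bsub>M\<^esub> (h, j) = \<zero>\<^bsub>A h\<^esub>"
    and "\<one>\<^bsub>M\<^esub> (h, j) = (if h = j then \<one>\<^bsub>A h\<^esub> else \<zero>\<^bsub>A h\<^esub>)"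
    and "(c \<odot>\<^bsub>M\<^esub> a) (h, j) = c \<odot>\<^bsub>A h\<^esub> a (h, j)"
    and "(a \<otimes>\<^bsub>M\<^esub> b) (h, j) = (if (h, j) \<in> P
      then \<Oplus>\<^bsub>A h\<^esub> i \<in> {i \<in> C. (h, i) \<in> P \<and> (i, j) \<in> P}. a (h, i) \<otimes>\<^bsub>A h\<^esub> \<phi> h i (b (i, j))
      else \<zero>\<^bsub>A h\<^esub>)"
  using assms unfolding matrix_algebra_def by auto

lemma M_extensional:
  "a \<oplus>\<^bsub>M\<^esub> b \<in> extensional (C \<times> C)" "a \<otimes>\<^bsub>M\<^esub> b \<in> extensional (C \<times> C)"
  "\<zero>\<^bsub>M\<^esub> \<in> extensional (C \<times> C)" "\<one>\<^bsub>M\<^esub> \<in> extensional (C \<times> C)"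
  "c \<odot>\<^bsub>M\<^esub> a \<in> extensional (C \<times> C)" "x \<in> carrier M \<Longrightarrow> x \<in> extensional (C \<times> C)"
  by (auto simp: matrix_algebra_def PiE_iff)

lemma M_closed:
  "a \<in> carrier M \<Longrightarrow> b \<in> carrier M \<Longrightarrow> a \<oplus>\<^bsub>M\<^esub> b \<in> carrier M"
  "a \<in> carrier M \<Longrightarrow> b \<in> carrier M \<Longrightarrow> a \<otimes>\<^bsub>M\<^esub> b \<in> carrier M"
  "\<zero>\<^bsub>M\<^esub> \<in> carrier M" "\<one>\<^bsub>M\<^esub> \<in> carrier M"
  "c \<in> carrier k \<Longrightarrow> a \<in> carrier M \<Longrightarrow> c \<odot>\<^bsub>M\<^esub> a \<in> carrier M"
proof -
  have r: "\<And>i. i \<in> C \<Longrightarrow> abelian_monoid (A i)"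
    using ring_A by (simp add: ring.is_abelian_group abelian_group.axioms)
  show "a \<oplus>\<^bsub>M\<^esub> b \<in> carrier M" if "a \<in> carrier M" "b \<in> carrier M"
    using that by (subst carrier_M)
      (auto simp: M_extensional M_apply M_entry M_zero_entry r abelian_monoid.a_closed
        abelian_monoid.l_zero abelian_monoid.zero_closed)
  show "a \<otimes>\<^bsub>M\<^esub> b \<in> carrier M" if "a \<in> carrier M" "b \<in> carrier M"
    using that by (subst carrier_M)
      (auto simp: M_extensional M_apply M_entry phi_closed ring_A ring.ring_simprules
        intro!: r abelian_monoid.finsum_closed)
  show "\<zero>\<^bsub>M\<^esub> \<in> carrier M"
    by (subst carrier_M) (auto simp: M_extensional M_apply r abelian_monoid.zero_closed)
  show "\<one>\<^bsub>M\<^esub> \<in> carrier M"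
    by (subst carrier_M)
      (auto simp: M_extensional M_apply r abelian_monoid.zero_closed P_refl
        ring.is_monoid ring_A monoid.one_closed)
  show "c \<odot>\<^bsub>M\<^esub> a \<in> carrier M" if "c \<in> carrier k" "a \<in> carrier M"
    using that by (subst carrier_M)
      (auto simp: M_extensional M_apply M_entry M_zero_entry module_A
        module.smult_closed[OF module_A] module.smult_r_null[OF module_A])
qed

lemma M_abelian_group: "abelian_group M"
proof (rule abelian_groupI)
  fix a b c assume a: "a \<in> carrier M" and b: "b \<in> carrier M" and c: "c \<in> carrier M"
  show "a \<oplus>\<^bsub>M\<^esub> b \<oplus>\<^bsub>M\<^esub> c = a \<oplus>\<^bsub>M\<^esub> (b \<oplus>\<^bsub>M\<^esub> c)"
    using a b c by (intro matrix_algebra_eqI[of _ C])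
      (auto simp: M_extensional M_apply M_entry ring_A ring.ring_simprules)
next
  fix a b assume a: "a \<in> carrier M" and b: "b \<in> carrier M"
  show "a \<oplus>\<^bsub>M\<^esub> b = b \<oplus>\<^bsub>M\<^esub> a"
    using a b by (intro matrix_algebra_eqI[of _ C])
      (auto simp: M_extensional M_apply M_entry ring_A intro: ring.ring_simprules)
next
  fix a assume a: "a \<in> carrier M"
  show "\<zero>\<^bsub>M\<^esub> \<oplus>\<^bsub>M\<^esub> a = a"
    using a by (intro matrix_algebra_eqI[of _ C])
      (auto simp: M_extensional M_apply M_entry ring_A ring.ring_simprules)
  define b where "b = (\<lambda>(i, j) \<in> C \<times> C. \<ominus>\<^bsub>A i\<^esub> a (i, j))"
  have "b \<in> carrier M"
    using a by (subst carrier_M)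
      (auto simp: b_def M_entry M_zero_entry ring_A ring.ring_simprules)
  moreover have "b \<oplus>\<^bsub>M\<^esub> a = \<zero>\<^bsub>M\<^esub>"
    using a by (intro matrix_algebra_eqI[of _ C])
      (auto simp: b_def M_extensional M_apply M_entry ring_A ring.ring_simprules)
  ultimately show "\<exists>b\<in>carrier M. b \<oplus>\<^bsub>M\<^esub> a = \<zero>\<^bsub>M\<^esub>" by blast
qed (auto simp: M_closed)


text \<open>Extending the maps by zero lets the sums in a product range over all of \<open>C\<close>.\<close>

definition Phi where "Phi h i x = (if (h, i) \<in> P then \<phi> h i x else \<zero>\<^bsub>A h\<^esub>)"

lemma Phi_closed: "h \<in> C \<Longrightarrow> x \<in> carrier (A i) \<Longrightarrow> Phi h i x \<in> carrier (A h)"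
  by (simp add: Phi_def phi_closed ring_A ring.ring_simprules)

lemma Phi_zero: "h \<in> C \<Longrightarrow> Phi h i \<zero>\<^bsub>A i\<^esub> = \<zero>\<^bsub>A h\<^esub>"
  by (simp add: Phi_def phi_zero)

lemma Phi_add: "h \<in> C \<Longrightarrow> x \<in> carrier (A i) \<Longrightarrow> y \<in> carrier (A i) \<Longrightarrow>
    Phi h i (x \<oplus>\<^bsub>A i\<^esub> y) = Phi h i x \<oplus>\<^bsub>A h\<^esub> Phi h i y"
  by (simp add: Phi_def phi_add ring_A ring.ring_simprules)

lemma Phi_mult: "h \<in> C \<Longrightarrow> x \<in> carrier (A i) \<Longrightarrow> y \<in> carrier (A i) \<Longrightarrow>
    Phi h i (x \<otimes>\<^bsub>A i\<^esub> y) = Phi h i x \<otimes>\<^bsub>A h\<^esub> Phi h i y"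
  by (simp add: Phi_def phi_mult ring_A ring.ring_simprules)

lemma Phi_smult: "h \<in> C \<Longrightarrow> c \<in> carrier k \<Longrightarrow> x \<in> carrier (A i) \<Longrightarrow>
    Phi h i (c \<odot>\<^bsub>A i\<^esub> x) = c \<odot>\<^bsub>A h\<^esub> Phi h i x"
  by (simp add: Phi_def phi_smult module_A module.smult_r_null[OF module_A])

context
  assumes fin: "finite C"
begin

lemma M_mult_apply:
  assumes a: "a \<in> carrier M" and b: "b \<in> carrier M" and h: "h \<in> C" and j: "j \<in> C"
  shows "(a \<otimes>\<^bsub>M\<^esub> b) (h, j) = (\<Oplus>\<^bsub>A h\<^esub> i \<in> C. a (h, i) \<otimes>\<^bsub>A h\<^esub> Phi h i (b (i, j)))"
proof -
  interpret ring "A h" using ring_A h by simp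
  let ?S = "{i \<in> C. (h, i) \<in> P \<and> (i, j) \<in> P}"
  have cl: "(\<lambda>i. a (h, i) \<otimes>\<^bsub>A h\<^esub> Phi h i (b (i, j))) \<in> C \<rightarrow> carrier (A h)"
    using a b h j by (auto simp: Phi_closed M_entry)
  have "(\<Oplus>\<^bsub>A h\<^esub> i \<in> ?S. a (h, i) \<otimes>\<^bsub>A h\<^esub> \<phi> h i (b (i, j)))
      = (\<Oplus>\<^bsub>A h\<^esub> i \<in> C. a (h, i) \<otimes>\<^bsub>A h\<^esub> Phi h i (b (i, j)))"
  proof (rule add.finprod_mono_neutral_cong_left[OF fin])
    fix i assume i: "i \<in> C - ?S"
    show "a (h, i) \<otimes>\<^bsub>A h\<^esub> Phi h i (b (i, j)) = \<zero>\<^bsub>A h\<^esub>"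
    proof (cases "(h, i) \<in> P")
      case True
      then show ?thesis using i a b h j by (auto simp: M_zero_entry[of b] Phi_zero M_entry)
    next
      case False
      then show ?thesis using i a b h j by (auto simp: Phi_def M_entry)
    qed
  qed (use cl in \<open>auto simp: Phi_def\<close>)
  moreover have "?S = {}" if "(h, j) \<notin> P" using that P_trans by blast
  ultimately show ?thesis
    using h j by (cases "(h, j) \<in> P") (auto simp: M_apply)
qed

lemma M_mult_assoc:
  assumes a: "a \<in> carrier M" and b: "b \<in> carrier M" and c: "c \<in> carrier M"
  shows "(a \<otimes>\<^bsub>M\<^esub> b) \<otimes>\<^bsub>M\<^esub> c = a \<otimes>\<^bsub>M\<^esub> (b \<otimes>\<^bsub>M\<^esub> c)"
proof (rule matrix_algebra_eqI[of _ C])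
  fix h j assume h: "h \<in> C" and j: "j \<in> C"
  interpret ring "A h" using ring_A h by simp
  note cl = M_entry[OF a] M_entry[OF b] M_entry[OF c] Phi_closed h j
  have *: "a (h, s) \<otimes>\<^bsub>A h\<^esub> Phi h s (b (s, i) \<otimes>\<^bsub>A s\<^esub> Phi s i (c (i, j)))
      = a (h, s) \<otimes>\<^bsub>A h\<^esub> Phi h s (b (s, i)) \<otimes>\<^bsub>A h\<^esub> Phi h i (c (i, j))"
    if s: "s \<in> C" and i: "i \<in> C" for s i
  proof (cases "(h, s) \<in> P \<and> (s, i) \<in> P")
    case True
    then have "Phi h s (Phi s i (c (i, j))) = Phi h i (c (i, j))"
      using P_trans[of h s i] cl s i by (auto simp: Phi_def map_comp)
    then show ?thesis
      using cl s i by (simp add: Phi_mult m_assoc)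
  next
    case False
    then consider "(h, s) \<notin> P" | "(s, i) \<notin> P" by blast
    then show ?thesis
    proof cases
      case 1
      then show ?thesis using cl s i by (simp add: Phi_def[of h s])
    next
      case 2
      interpret s: ring "A s" using ring_A s by simp
      show ?thesis using 2 cl s i by (simp add: M_zero_entry[OF b] Phi_zero)
    qed
  qed
  have "((a \<otimes>\<^bsub>M\<^esub> b) \<otimes>\<^bsub>M\<^esub> c) (h, j)
      = (\<Oplus>\<^bsub>A h\<^esub> i \<in> C. (\<Oplus>\<^bsub>A h\<^esub> s \<in> C. a (h, s) \<otimes>\<^bsub>A h\<^esub> Phi h s (b (s, i))) \<otimes>\<^bsub>A h\<^esub> Phi h i (c (i, j)))"
    using cl a b c by (subst M_mult_apply) (auto simp: M_closed M_mult_apply intro!: finsum_cong')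
  also have "\<dots> = (\<Oplus>\<^bsub>A h\<^esub> i \<in> C. \<Oplus>\<^bsub>A h\<^esub> s \<in> C. a (h, s) \<otimes>\<^bsub>A h\<^esub> Phi h s (b (s, i)) \<otimes>\<^bsub>A h\<^esub> Phi h i (c (i, j)))"
    using cl by (intro finsum_cong' refl finsum_ldistr fin) auto
  also have "\<dots> = (\<Oplus>\<^bsub>A h\<^esub> s \<in> C. \<Oplus>\<^bsub>A h\<^esub> i \<in> C. a (h, s) \<otimes>\<^bsub>A h\<^esub> Phi h s (b (s, i)) \<otimes>\<^bsub>A h\<^esub> Phi h i (c (i, j)))"
    using cl by (intro finsum_swap fin) (auto simp: abelian_monoid_axioms)
  also have "\<dots> = (\<Oplus>\<^bsub>A h\<^esub> s \<in> C. a (h, s) \<otimes>\<^bsub>A h\<^esub> (\<Oplus>\<^bsub>A h\<^esub> i \<in> C. Phi h s (b (s, i) \<otimes>\<^bsub>A s\<^esub> Phi s i (c (i, j)))))"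
  proof (intro finsum_cong' refl)
    fix s assume s: "s \<in> C"
    interpret s: ring "A s" using ring_A s by simp
    have "(\<Oplus>\<^bsub>A h\<^esub> i \<in> C. a (h, s) \<otimes>\<^bsub>A h\<^esub> Phi h s (b (s, i)) \<otimes>\<^bsub>A h\<^esub> Phi h i (c (i, j)))
        = (\<Oplus>\<^bsub>A h\<^esub> i \<in> C. a (h, s) \<otimes>\<^bsub>A h\<^esub> Phi h s (b (s, i) \<otimes>\<^bsub>A s\<^esub> Phi s i (c (i, j))))"
      using cl s by (intro finsum_cong' refl) (auto simp: *)
    also have "\<dots> = a (h, s) \<otimes>\<^bsub>A h\<^esub> (\<Oplus>\<^bsub>A h\<^esub> i \<in> C. Phi h s (b (s, i) \<otimes>\<^bsub>A s\<^esub> Phi s i (c (i, j))))"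
      using cl s by (intro finsum_rdistr[symmetric] fin) auto
    finally show "(\<Oplus>\<^bsub>A h\<^esub> i \<in> C. a (h, s) \<otimes>\<^bsub>A h\<^esub> Phi h s (b (s, i)) \<otimes>\<^bsub>A h\<^esub> Phi h i (c (i, j)))
        = a (h, s) \<otimes>\<^bsub>A h\<^esub> (\<Oplus>\<^bsub>A h\<^esub> i \<in> C. Phi h s (b (s, i) \<otimes>\<^bsub>A s\<^esub> Phi s i (c (i, j))))" .
  qed (use cl ring_A in \<open>auto intro!: m_closed finsum_closed Phi_closed simp: ring.ring_simprules\<close>)
  also have "\<dots> = (a \<otimes>\<^bsub>M\<^esub> (b \<otimes>\<^bsub>M\<^esub> c)) (h, j)"
  proof -
    have "Phi h s ((b \<otimes>\<^bsub>M\<^esub> c) (s, j)) = (\<Oplus>\<^bsub>A h\<^esub> i \<in> C. Phi h s (b (s, i) \<otimes>\<^bsub>A s\<^esub> Phi s i (c (i, j))))"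
      if s: "s \<in> C" for s
    proof -
      interpret s: ring "A s" using ring_A s by simp
      show ?thesis using cl s b c
        by (subst M_mult_apply, simp_all, intro additive_finsum fin)
          (auto simp: Phi_zero Phi_add s.abelian_monoid_axioms abelian_monoid_axioms)
    qed
    moreover have "Phi h s (b (s, i) \<otimes>\<^bsub>A s\<^esub> Phi s i (c (i, j))) \<in> carrier (A h)"
      if "s \<in> C" "i \<in> C" for s i
      using cl ring_A that by (simp add: ring.ring_simprules)
    ultimately show ?thesis
      using cl a b c by (subst M_mult_apply)
        (auto simp: M_closed M_entry intro!: finsum_cong' m_closed finsum_closed)
  qed
  finally show "((a \<otimes>\<^bsub>M\<^esub> b) \<otimes>\<^bsub>M\<^esub> c) (h, j) = (a \<otimes>\<^bsub>M\<^esub> (b \<otimes>\<^bsub>M\<^esub> c)) (h, j)" .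
qed (auto simp: M_extensional)

lemma M_one:
  assumes a: "a \<in> carrier M"
  shows "\<one>\<^bsub>M\<^esub> \<otimes>\<^bsub>M\<^esub> a = a" "a \<otimes>\<^bsub>M\<^esub> \<one>\<^bsub>M\<^esub> = a"
proof -
  show "\<one>\<^bsub>M\<^esub> \<otimes>\<^bsub>M\<^esub> a = a"
  proof (rule matrix_algebra_eqI[of _ C])
    fix h j assume h: "h \<in> C" and j: "j \<in> C"
    interpret ring "A h" using ring_A h by simp
    have "(\<one>\<^bsub>M\<^esub> \<otimes>\<^bsub>M\<^esub> a) (h, j) = (\<Oplus>\<^bsub>A h\<^esub> i \<in> C. if h = i then a (i, j) else \<zero>\<^bsub>A h\<^esub>)"
      using h j a by (subst M_mult_apply)
        (auto simp: M_closed M_apply M_entry Phi_closed Phi_def P_refl map_id phi_closed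
          intro!: finsum_cong')
    also have "\<dots> = (\<Oplus>\<^bsub>A h\<^esub> i \<in> C. if h = i then a (h, j) else \<zero>\<^bsub>A h\<^esub>)"
      using h j a by (intro finsum_cong' refl) (auto simp: M_entry)
    also have "\<dots> = a (h, j)"
      using h j a fin by (intro finsum_singleton) (auto simp: M_entry)
    finally show "(\<one>\<^bsub>M\<^esub> \<otimes>\<^bsub>M\<^esub> a) (h, j) = a (h, j)" .
  qed (use a in \<open>auto simp: M_extensional\<close>)
  show "a \<otimes>\<^bsub>M\<^esub> \<one>\<^bsub>M\<^esub> = a"
  proof (rule matrix_algebra_eqI[of _ C])
    fix h j assume h: "h \<in> C" and j: "j \<in> C"
    interpret ring "A h" using ring_A h by simp
    have "(a \<otimes>\<^bsub>M\<^esub> \<one>\<^bsub>M\<^esub>) (h, j) = (\<Oplus>\<^bsub>A h\<^esub> i \<in> C. if j = i then a (h, i) else \<zero>\<^bsub>A h\<^esub>)"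
      using h j a by (subst M_mult_apply)
        (auto simp: M_closed M_apply M_entry Phi_def phi_one phi_zero M_zero_entry
          intro!: finsum_cong')
    also have "\<dots> = a (h, j)"
      using h j a fin by (intro finsum_singleton) (auto simp: M_entry)
    finally show "(a \<otimes>\<^bsub>M\<^esub> \<one>\<^bsub>M\<^esub>) (h, j) = a (h, j)" .
  qed (use a in \<open>auto simp: M_extensional\<close>)
qed

lemma M_distr:
  assumes a: "a \<in> carrier M" and b: "b \<in> carrier M" and c: "c \<in> carrier M"
  shows "(a \<oplus>\<^bsub>M\<^esub> b) \<otimes>\<^bsub>M\<^esub> c = a \<otimes>\<^bsub>M\<^esub> c \<oplus>\<^bsub>M\<^esub> b \<otimes>\<^bsub>M\<^esub> c"
    and "c \<otimes>\<^bsub>M\<^esub> (a \<oplus>\<^bsub>M\<^esub> b) = c \<otimes>\<^bsub>M\<^esub> a \<oplus>\<^bsub>M\<^esub> c \<otimes>\<^bsub>M\<^esub> b"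
proof -
  note cl = M_entry[OF a] M_entry[OF b] M_entry[OF c] Phi_closed a b c M_closed
  show "(a \<oplus>\<^bsub>M\<^esub> b) \<otimes>\<^bsub>M\<^esub> c = a \<otimes>\<^bsub>M\<^esub> c \<oplus>\<^bsub>M\<^esub> b \<otimes>\<^bsub>M\<^esub> c"
  proof (rule matrix_algebra_eqI[of _ C])
    fix h j assume h: "h \<in> C" and j: "j \<in> C"
    interpret ring "A h" using ring_A h by simp
    show "((a \<oplus>\<^bsub>M\<^esub> b) \<otimes>\<^bsub>M\<^esub> c) (h, j) = (a \<otimes>\<^bsub>M\<^esub> c \<oplus>\<^bsub>M\<^esub> b \<otimes>\<^bsub>M\<^esub> c) (h, j)"
      using cl h j by (auto simp: M_mult_apply M_apply(1) l_distr
          intro!: finsum_addf[symmetric] trans[OF finsum_cong' finsum_addf])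
  qed (auto simp: M_extensional)
  show "c \<otimes>\<^bsub>M\<^esub> (a \<oplus>\<^bsub>M\<^esub> b) = c \<otimes>\<^bsub>M\<^esub> a \<oplus>\<^bsub>M\<^esub> c \<otimes>\<^bsub>M\<^esub> b"
  proof (rule matrix_algebra_eqI[of _ C])
    fix h j assume h: "h \<in> C" and j: "j \<in> C"
    interpret ring "A h" using ring_A h by simp
    show "(c \<otimes>\<^bsub>M\<^esub> (a \<oplus>\<^bsub>M\<^esub> b)) (h, j) = (c \<otimes>\<^bsub>M\<^esub> a \<oplus>\<^bsub>M\<^esub> c \<otimes>\<^bsub>M\<^esub> b) (h, j)"
      using cl h j by (auto simp: M_mult_apply M_apply(1) r_distr Phi_add
          intro!: trans[OF finsum_cong' finsum_addf])
  qed (auto simp: M_extensional)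
qed

lemma ring_matrix_algebra: "ring M"
  by (intro ringI M_abelian_group monoidI)
    (auto simp: M_closed M_mult_assoc M_one M_distr)

theorem assoc_algebra_matrix_algebra: "assoc_algebra k M"
proof -
  have *: "module k M"
  proof (rule moduleI)
    show "cring k" by unfold_locales
    fix c x assume c: "c \<in> carrier k" and x: "x \<in> carrier M"
    show "c \<odot>\<^bsub>M\<^esub> x \<in> carrier M" using c x by (rule M_closed)
  next
    fix c d x assume c: "c \<in> carrier k" and d: "d \<in> carrier k" and x: "x \<in> carrier M"
    show "(c \<oplus>\<^bsub>k\<^esub> d) \<odot>\<^bsub>M\<^esub> x = c \<odot>\<^bsub>M\<^esub> x \<oplus>\<^bsub>M\<^esub> d \<odot>\<^bsub>M\<^esub> x"
      using c d x by (intro matrix_algebra_eqI[of _ C])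
        (auto simp: M_extensional M_apply M_entry module_A module.smult_l_distr[OF module_A])
    show "c \<otimes>\<^bsub>k\<^esub> d \<odot>\<^bsub>M\<^esub> x = c \<odot>\<^bsub>M\<^esub> (d \<odot>\<^bsub>M\<^esub> x)"
      using c d x by (intro matrix_algebra_eqI[of _ C])
        (auto simp: M_extensional M_apply M_entry module_A module.smult_assoc1[OF module_A])
  next
    fix c x y assume c: "c \<in> carrier k" and x: "x \<in> carrier M" and y: "y \<in> carrier M"
    show "c \<odot>\<^bsub>M\<^esub> (x \<oplus>\<^bsub>M\<^esub> y) = c \<odot>\<^bsub>M\<^esub> x \<oplus>\<^bsub>M\<^esub> c \<odot>\<^bsub>M\<^esub> y"
      using c x y by (intro matrix_algebra_eqI[of _ C])
        (auto simp: M_extensional M_apply M_entry module_A module.smult_r_distr[OF module_A])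
  next
    fix x assume x: "x \<in> carrier M"
    show "\<one>\<^bsub>k\<^esub> \<odot>\<^bsub>M\<^esub> x = x"
      using x by (intro matrix_algebra_eqI[of _ C])
        (auto simp: M_extensional M_apply M_entry module_A module.smult_one[OF module_A])
  qed (rule M_abelian_group)
  show ?thesis
  proof (intro assoc_algebra.intro * ring_matrix_algebra assoc_algebra_axioms.intro)
    fix c x y assume c: "c \<in> carrier k" and x: "x \<in> carrier M" and y: "y \<in> carrier M"
    have sum: "c \<odot>\<^bsub>A h\<^esub> (\<Oplus>\<^bsub>A h\<^esub> i \<in> C. g i) = (\<Oplus>\<^bsub>A h\<^esub> i \<in> C. c \<odot>\<^bsub>A h\<^esub> g i)"
      if "h \<in> C" "g \<in> C \<rightarrow> carrier (A h)" for h g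
    proof -
      interpret h: assoc_algebra k "A h" using algebra that by simp
      show ?thesis
        using c that by (intro additive_finsum fin)
          (auto simp: h.M.abelian_monoid_axioms h.smult_r_distr)
    qed
    show "(c \<odot>\<^bsub>M\<^esub> x) \<otimes>\<^bsub>M\<^esub> y = c \<odot>\<^bsub>M\<^esub> (x \<otimes>\<^bsub>M\<^esub> y)"
    proof (rule matrix_algebra_eqI[of _ C])
      fix h j assume h: "h \<in> C" and j: "j \<in> C"
      interpret h: assoc_algebra k "A h" using algebra h by simp
      show "((c \<odot>\<^bsub>M\<^esub> x) \<otimes>\<^bsub>M\<^esub> y) (h, j) = (c \<odot>\<^bsub>M\<^esub> (x \<otimes>\<^bsub>M\<^esub> y)) (h, j)"
        using c x y h j
        by (auto simp: M_apply(4) M_mult_apply M_closed M_entry Phi_closed sum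
            h.smult_mult_left intro!: h.M.finsum_cong')
    qed (auto simp: M_extensional)
    show "x \<otimes>\<^bsub>M\<^esub> (c \<odot>\<^bsub>M\<^esub> y) = c \<odot>\<^bsub>M\<^esub> (x \<otimes>\<^bsub>M\<^esub> y)"
    proof (rule matrix_algebra_eqI[of _ C])
      fix h j assume h: "h \<in> C" and j: "j \<in> C"
      interpret h: assoc_algebra k "A h" using algebra h by simp
      show "(x \<otimes>\<^bsub>M\<^esub> (c \<odot>\<^bsub>M\<^esub> y)) (h, j) = (c \<odot>\<^bsub>M\<^esub> (x \<otimes>\<^bsub>M\<^esub> y)) (h, j)"
        using c x y h j
        by (auto simp: M_apply(4) M_mult_apply M_closed M_entry Phi_closed Phi_smult sum
            h.smult_mult_right intro!: h.M.finsum_cong')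
    qed (auto simp: M_extensional)
  qed
qed

end

end


section \<open>Clean, nil-clean and exchange rings\<close>

definition idempotents :: "('a, 'm) ring_scheme \<Rightarrow> 'a set"
  where "idempotents R = {e \<in> carrier R. e \<otimes>\<^bsub>R\<^esub> e = e}"

definition nilpotents :: "('a, 'm) ring_scheme \<Rightarrow> 'a set"
  where "nilpotents R = {x \<in> carrier R. \<exists>m::nat. x [^]\<^bsub>R\<^esub> m = \<zero>\<^bsub>R\<^esub>}"

locale clean_ring = ring +
  assumes clean: "a \<in> carrier R \<Longrightarrow> \<exists>e\<in>idempotents R. \<exists>u\<in>Units R. a = e \<oplus> u"

locale nil_clean_ring = ring +
  assumes nil_clean: "a \<in> carrier R \<Longrightarrow> \<exists>e\<in>idempotents R. \<exists>n\<in>nilpotents R. a = e \<oplus> n"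

locale exchange_ring = ring +
  assumes exchange: "a \<in> carrier R \<Longrightarrow> \<exists>e\<in>idempotents R.
    (\<exists>x\<in>carrier R. e = a \<otimes> x) \<and> (\<exists>y\<in>carrier R. \<one> \<ominus> e = (\<one> \<ominus> a) \<otimes> y)"

end

theory Submission
  imports Defs
begin

text \<open>
  The diagonal entries give ring homomorphisms \<open>M \<rightarrow> A i\<close> that are jointly onto, and their common
  kernel consists of the strictly upper triangular matrices, which are nilpotent because \<open>C\<close> is
  finite. Hence a matrix is invertible, or nilpotent, as soon as all its diagonal entries are.
  Idempotents of the \<open>A i\<close> lift to diagonal idempotent matrices \<open>e\<close>, and then a decomposition of
  the diagonal lifts to \<open>a = e + (a - e)\<close>. For the exchange property, suppose that \<open>p \<in> a M\<close> and
  \<open>q \<in> (1 - a) M\<close> have the same diagonals as \<open>e\<close> and \<open>1 - e\<close>. Then \<open>w = p e + q (1 - e)\<close> is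
  invertible with \<open>w e = p e\<close> and \<open>w (1 - e) = q (1 - e)\<close>, so the idempotent \<open>w e w\<inverse>\<close> lies in
  \<open>a M\<close> and its complement lies in \<open>(1 - a) M\<close>.
\<close>

section \<open>Nilpotent and invertible elements\<close>

context ring
begin

text \<open>Geometric series: the induction builds \<open>s = 1 + x + ... + x^(n-1)\<close>,
  starting from the empty sum 0 at \<open>n = 0\<close>. Once \<open>x^n = 0\<close>, this
  \<open>s\<close> is a two-sided inverse.\<close>

lemma one_minus_nilpotent_Units:
  assumes "x \<in> nilpotents R"
  shows "\<one> \<ominus> x \<in> Units R"
proof -
  from assms obtain m :: nat where x: "x \<in> carrier R" and m: "x [^] m = \<zero>"
    by (auto simp: nilpotents_def)
  have "\<exists>s\<in>carrier R. (\<one> \<ominus> x) \<otimes> s = \<one> \<ominus> x [^] n \<and> s \<otimes> (\<one> \<ominus> x) = \<one> \<ominus> x [^] n" for n :: nat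
  proof (induction n)
    case 0
    show ?case using x by (intro bexI[of _ \<zero>]) (auto simp: a_minus_def r_neg)
  next
    case (Suc n)
    then obtain s where s: "s \<in> carrier R" "(\<one> \<ominus> x) \<otimes> s = \<one> \<ominus> x [^] n"
      "s \<otimes> (\<one> \<ominus> x) = \<one> \<ominus> x [^] n" by blast
    have "(\<one> \<ominus> x) \<otimes> (s \<oplus> x [^] n) = (\<one> \<ominus> x [^] n) \<oplus> (\<one> \<ominus> x) \<otimes> x [^] n"
      using s x by (simp add: r_distr)
    also have "\<dots> = \<one> \<ominus> x \<otimes> x [^] n"
      using x by (simp add: a_minus_def l_distr l_minus a_assoc r_neg1)
    also have "\<dots> = \<one> \<ominus> x [^] Suc n"
      using x nat_pow_Suc2 by simp
    finally have l: "(\<one> \<ominus> x) \<otimes> (s \<oplus> x [^] n) = \<one> \<ominus> x [^] Suc n" .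
    have "(s \<oplus> x [^] n) \<otimes> (\<one> \<ominus> x) = (\<one> \<ominus> x [^] n) \<oplus> x [^] n \<otimes> (\<one> \<ominus> x)"
      using s x by (simp add: l_distr)
    also have "\<dots> = \<one> \<ominus> x [^] n \<otimes> x"
      using x by (simp add: a_minus_def r_distr r_minus a_assoc r_neg1)
    finally show ?case
      using l s x by (intro bexI[of _ "s \<oplus> x [^] n"]) auto
  qed
  from this[of m] obtain s where "s \<in> carrier R" "(\<one> \<ominus> x) \<otimes> s = \<one>" "s \<otimes> (\<one> \<ominus> x) = \<one>"
    using m by (auto simp: a_minus_def)
  then show ?thesis using x by (auto simp: Units_def)
qed

lemma nilpotents_of_pow:
  assumes "x \<in> carrier R" "x [^] (m::nat) \<in> nilpotents R"
  shows "x \<in> nilpotents R"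
  using assms by (auto simp: nilpotents_def nat_pow_pow)

lemma nat_pow_eq_zero_mono:
  assumes "x \<in> carrier R" "x [^] (m::nat) = \<zero>" "m \<le> n"
  shows "x [^] n = \<zero>"
  using assms nat_pow_mult[of x m "n - m"] by simp

text \<open>\<open>y (x y)^-1\<close> is a right inverse of \<open>x\<close> and
  \<open>(y x)^-1 y\<close> a left one, so the two agree. This serves a candidate inverse
  \<open>y\<close> that is correct only modulo nilpotents.\<close>

lemma UnitsI_one_sided:
  assumes "x \<in> carrier R" "y \<in> carrier R" "x \<otimes> y \<in> Units R" "y \<otimes> x \<in> Units R"
  shows "x \<in> Units R"
proof -
  let ?r = "y \<otimes> inv (x \<otimes> y)" and ?l = "inv (y \<otimes> x) \<otimes> y"
  have cl: "?r \<in> carrier R" "?l \<in> carrier R" using assms by auto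
  have r: "x \<otimes> ?r = \<one>" using assms by (simp add: m_assoc[symmetric])
  have l: "?l \<otimes> x = \<one>" using assms by (simp add: m_assoc)
  have "?l = ?l \<otimes> (x \<otimes> ?r)" using r cl by simp
  also have "\<dots> = ?r" using l cl assms(1) by (simp add: m_assoc[symmetric] del: r)
  finally show ?thesis using r l cl assms(1) by (auto simp: Units_def)
qed

end

section \<open>Surjective homomorphisms\<close>

context ring_hom_ring
begin

lemma hom_minus:
  "x \<in> carrier R \<Longrightarrow> y \<in> carrier R \<Longrightarrow> h (x \<ominus>\<^bsub>R\<^esub> y) = h x \<ominus>\<^bsub>S\<^esub> h y"
  by (simp add: a_minus_def)

lemma hom_idempotents: "e \<in> idempotents R \<Longrightarrow> h e \<in> idempotents S"
  by (auto simp: idempotents_def hom_mult[symmetric] simp del: hom_mult)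

lemma hom_nilpotents: "x \<in> nilpotents R \<Longrightarrow> h x \<in> nilpotents S"
proof -
  assume "x \<in> nilpotents R"
  then obtain m :: nat where x: "x \<in> carrier R" and m: "x [^]\<^bsub>R\<^esub> m = \<zero>\<^bsub>R\<^esub>"
    by (auto simp: nilpotents_def)
  have "h x [^]\<^bsub>S\<^esub> m = \<zero>\<^bsub>S\<^esub>" using hom_nat_pow[OF x, of m] m by simp
  then show ?thesis using x by (auto simp: nilpotents_def)
qed

lemma hom_Units: "u \<in> Units R \<Longrightarrow> h u \<in> Units S"
proof -
  assume u: "u \<in> Units R"
  then have "h u \<otimes>\<^bsub>S\<^esub> h (inv\<^bsub>R\<^esub> u) = \<one>\<^bsub>S\<^esub>" "h (inv\<^bsub>R\<^esub> u) \<otimes>\<^bsub>S\<^esub> h u = \<one>\<^bsub>S\<^esub>"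
    using R.Units_closed[OF u] hom_mult[of u "inv\<^bsub>R\<^esub> u"] hom_mult[of "inv\<^bsub>R\<^esub> u" u]
    by (simp_all del: hom_mult)
  then show ?thesis using hom_closed[of u] hom_closed[of "inv\<^bsub>R\<^esub> u"] u
    unfolding Units_def[of S] by blast
qed

section \<open>The three properties pass to surjective images\<close>

lemma surj_clean_ring:
  assumes "h ` carrier R = carrier S" "clean_ring R"
  shows "clean_ring S"
proof
  fix b assume "b \<in> carrier S"
  then obtain a where a: "a \<in> carrier R" "b = h a" using assms(1) by blast
  with clean_ring.clean[OF assms(2)] obtain e u
    where e: "e \<in> idempotents R" and u: "u \<in> Units R" and "a = e \<oplus>\<^bsub>R\<^esub> u" by blast
  moreover have "e \<in> carrier R" "u \<in> carrier R" using e u by (auto simp: idempotents_def)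
  ultimately have "b = h e \<oplus>\<^bsub>S\<^esub> h u" using a(2) by simp
  then show "\<exists>e\<in>idempotents S. \<exists>u\<in>Units S. b = e \<oplus>\<^bsub>S\<^esub> u"
    using hom_idempotents[OF e] hom_Units[OF u] by blast
qed

lemma surj_nil_clean_ring:
  assumes "h ` carrier R = carrier S" "nil_clean_ring R"
  shows "nil_clean_ring S"
proof
  fix b assume "b \<in> carrier S"
  then obtain a where a: "a \<in> carrier R" "b = h a" using assms(1) by blast
  with nil_clean_ring.nil_clean[OF assms(2)] obtain e n
    where e: "e \<in> idempotents R" and n: "n \<in> nilpotents R" and "a = e \<oplus>\<^bsub>R\<^esub> n" by blast
  moreover have "e \<in> carrier R" "n \<in> carrier R"
    using e n by (auto simp: idempotents_def nilpotents_def)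
  ultimately have "b = h e \<oplus>\<^bsub>S\<^esub> h n" using a(2) by simp
  then show "\<exists>e\<in>idempotents S. \<exists>n\<in>nilpotents S. b = e \<oplus>\<^bsub>S\<^esub> n"
    using hom_idempotents[OF e] hom_nilpotents[OF n] by blast
qed

lemma surj_exchange_ring:
  assumes "h ` carrier R = carrier S" "exchange_ring R"
  shows "exchange_ring S"
proof
  fix b assume "b \<in> carrier S"
  then obtain a where a: "a \<in> carrier R" "b = h a" using assms(1) by blast
  with exchange_ring.exchange[OF assms(2)] obtain e x y
    where e: "e \<in> idempotents R" and x: "x \<in> carrier R" "e = a \<otimes>\<^bsub>R\<^esub> x"
      and y: "y \<in> carrier R" "\<one>\<^bsub>R\<^esub> \<ominus>\<^bsub>R\<^esub> e = (\<one>\<^bsub>R\<^esub> \<ominus>\<^bsub>R\<^esub> a) \<otimes>\<^bsub>R\<^esub> y" by blast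
  have eR: "e \<in> carrier R" using e by (simp add: idempotents_def)
  have "h e = b \<otimes>\<^bsub>S\<^esub> h x" using a x by simp
  moreover have "\<one>\<^bsub>S\<^esub> \<ominus>\<^bsub>S\<^esub> h e = (\<one>\<^bsub>S\<^esub> \<ominus>\<^bsub>S\<^esub> b) \<otimes>\<^bsub>S\<^esub> h y"
    using arg_cong[OF y(2), of h] a y(1) eR by (simp add: hom_minus)
  ultimately show "\<exists>e\<in>idempotents S. (\<exists>x\<in>carrier S. e = b \<otimes>\<^bsub>S\<^esub> x) \<and>
      (\<exists>y\<in>carrier S. \<one>\<^bsub>S\<^esub> \<ominus>\<^bsub>S\<^esub> e = (\<one>\<^bsub>S\<^esub> \<ominus>\<^bsub>S\<^esub> b) \<otimes>\<^bsub>S\<^esub> y)"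
    using hom_idempotents[OF e] hom_closed[OF x(1)] hom_closed[OF y(1)] by blast
qed

end

section \<open>Lifting along a family of homomorphisms with nil common kernel\<close>

text \<open>Together the \<open>h i\<close> map onto the product of the \<open>S i\<close> with nil
  kernel; stating \<open>lift\<close> for families avoids forming that product.
  \<open>lift_idempotent\<close> is a separate assumption because a preimage supplied by
  \<open>lift\<close> need not be idempotent.\<close>

locale nil_extension = ring R for R :: "('r, 'm) ring_scheme" (structure) +
  fixes I :: "'i set" and S :: "'i \<Rightarrow> ('s, 'n) ring_scheme" and h :: "'i \<Rightarrow> 'r \<Rightarrow> 's"
  assumes finite_index: "finite I"
    and ring_hom: "i \<in> I \<Longrightarrow> ring_hom_ring R (S i) (h i)"
    and lift: "(\<And>i. i \<in> I \<Longrightarrow> y i \<in> carrier (S i)) \<Longrightarrow> \<exists>x\<in>carrier R. \<forall>i\<in>I. h i x = y i"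
    and lift_idempotent:
      "(\<And>i. i \<in> I \<Longrightarrow> y i \<in> idempotents (S i)) \<Longrightarrow> \<exists>x\<in>idempotents R. \<forall>i\<in>I. h i x = y i"
    and nil: "x \<in> carrier R \<Longrightarrow> (\<And>i. i \<in> I \<Longrightarrow> h i x = \<zero>\<^bsub>S i\<^esub>) \<Longrightarrow> x \<in> nilpotents R"
begin

section \<open>Units and nilpotents are detected in the components\<close>

lemma ring_S: "i \<in> I \<Longrightarrow> ring (S i)"
  using ring_hom by (simp add: ring_hom_ring_def)

text \<open>The difference \<open>1 - x\<close> lies in the common kernel, so it is nilpotent and
  \<open>x = 1 - (1 - x)\<close> is invertible.\<close>

lemma Units_of_eq_one:
  assumes x: "x \<in> carrier R" and h: "\<And>i. i \<in> I \<Longrightarrow> h i x = \<one>\<^bsub>S i\<^esub>"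
  shows "x \<in> Units R"
proof -
  have "\<one> \<ominus> x \<in> nilpotents R"
  proof (rule nil)
    fix i assume i: "i \<in> I"
    interpret hi: ring_hom_ring R "S i" "h i" using i by (rule ring_hom)
    show "h i (\<one> \<ominus> x) = \<zero>\<^bsub>S i\<^esub>"
      using x h[OF i] by (simp add: hi.hom_minus a_minus_def hi.S.r_neg)
  qed (use x in simp)
  moreover have "\<one> \<ominus> (\<one> \<ominus> x) = x" using x by algebra
  ultimately show ?thesis using one_minus_nilpotent_Units by metis
qed

text \<open>Lifting the inverses of all \<open>h i u\<close> to one \<open>v\<close> makes
  \<open>u v\<close> and \<open>v u\<close> equal to 1 in every component. Both products are
  therefore units, although \<open>v\<close> itself need not invert \<open>u\<close>.\<close>

lemma lift_Units:
  assumes u: "u \<in> carrier R" and h: "\<And>i. i \<in> I \<Longrightarrow> h i u \<in> Units (S i)"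
  shows "u \<in> Units R"
proof -
  obtain v where v: "v \<in> carrier R" and hv: "\<And>i. i \<in> I \<Longrightarrow> h i v = inv\<^bsub>S i\<^esub> (h i u)"
    using lift[of "\<lambda>i. inv\<^bsub>S i\<^esub> (h i u)"] h ring_S
    by (metis monoid.Units_inv_closed ring.is_monoid)
  have "h i (u \<otimes> v) = \<one>\<^bsub>S i\<^esub> \<and> h i (v \<otimes> u) = \<one>\<^bsub>S i\<^esub>" if i: "i \<in> I" for i
  proof -
    interpret hi: ring_hom_ring R "S i" "h i" using i by (rule ring_hom)
    show ?thesis using u v hv[OF i] h[OF i] by simp
  qed
  then show ?thesis using u v by (intro UnitsI_one_sided[OF u v] Units_of_eq_one) auto
qed

lemma lift_nilpotents:
  assumes x: "x \<in> carrier R" and h: "\<And>i. i \<in> I \<Longrightarrow> h i x \<in> nilpotents (S i)"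
  shows "x \<in> nilpotents R"
proof -
  obtain m :: "'i \<Rightarrow> nat" where m: "\<And>i. i \<in> I \<Longrightarrow> h i x [^]\<^bsub>S i\<^esub> m i = \<zero>\<^bsub>S i\<^esub>"
    using h unfolding nilpotents_def by simp metis
  \<comment> \<open>Finiteness of \<open>I\<close> makes the sum of the exponents an upper bound for
    each of them, so this power lies in the common kernel.\<close>
  have "x [^] sum m I \<in> nilpotents R"
  proof (rule nil)
    fix i assume i: "i \<in> I"
    interpret hi: ring_hom_ring R "S i" "h i" using i by (rule ring_hom)
    have "m i \<le> sum m I" using i finite_index by (simp add: member_le_sum)
    then show "h i (x [^] sum m I) = \<zero>\<^bsub>S i\<^esub>"
      using x m[OF i] by (simp add: hi.hom_nat_pow hi.S.nat_pow_eq_zero_mono)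
  qed (use x in simp)
  then show ?thesis using x nilpotents_of_pow by blast
qed

section \<open>Lifting the three properties from the components\<close>

lemma clean_ring_lift:
  assumes "\<And>i. i \<in> I \<Longrightarrow> clean_ring (S i)"
  shows "clean_ring R"
proof
  fix a assume a: "a \<in> carrier R"
  have "\<exists>e u. e \<in> idempotents (S i) \<and> u \<in> Units (S i) \<and> h i a = e \<oplus>\<^bsub>S i\<^esub> u" if i: "i \<in> I" for i
  proof -
    interpret hi: ring_hom_ring R "S i" "h i" using i by (rule ring_hom)
    show ?thesis using clean_ring.clean[OF assms[OF i], of "h i a"] a by auto
  qed
  then obtain e' u where e': "\<And>i. i \<in> I \<Longrightarrow> e' i \<in> idempotents (S i)"
    and u: "\<And>i. i \<in> I \<Longrightarrow> u i \<in> Units (S i)"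
    and eu: "\<And>i. i \<in> I \<Longrightarrow> h i a = e' i \<oplus>\<^bsub>S i\<^esub> u i"
    by metis
  from lift_idempotent[OF e'] obtain e where e: "e \<in> idempotents R"
    and he: "\<And>i. i \<in> I \<Longrightarrow> h i e = e' i" by blast
  have eR: "e \<in> carrier R" using e by (simp add: idempotents_def)
  \<comment> \<open>With \<open>e\<close> chosen, the other summand is forced: \<open>a - e\<close>
    has image \<open>u i\<close> in each component.\<close>
  have "a \<ominus> e \<in> Units R"
  proof (rule lift_Units)
    fix i assume i: "i \<in> I"
    interpret hi: ring_hom_ring R "S i" "h i" using i by (rule ring_hom)
    have [simp]: "e' i \<in> carrier (S i)" "u i \<in> carrier (S i)"
      using e'[OF i] u[OF i] by (auto simp: idempotents_def)
    have "e' i \<oplus>\<^bsub>S i\<^esub> u i \<ominus>\<^bsub>S i\<^esub> e' i = u i"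
      by (simp add: a_minus_def hi.S.a_comm[of "e' i"] hi.S.a_assoc hi.S.r_neg)
    then show "h i (a \<ominus> e) \<in> Units (S i)"
      using a eR u[OF i] by (simp add: hi.hom_minus he[OF i] eu[OF i])
  qed (use a eR in simp)
  moreover have "a = e \<oplus> (a \<ominus> e)" using a eR by algebra
  ultimately show "\<exists>e\<in>idempotents R. \<exists>u\<in>Units R. a = e \<oplus> u" using e by blast
qed

lemma nil_clean_ring_lift:
  assumes "\<And>i. i \<in> I \<Longrightarrow> nil_clean_ring (S i)"
  shows "nil_clean_ring R"
proof
  fix a assume a: "a \<in> carrier R"
  have "\<exists>e n. e \<in> idempotents (S i) \<and> n \<in> nilpotents (S i) \<and> h i a = e \<oplus>\<^bsub>S i\<^esub> n"
    if i: "i \<in> I" for i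
  proof -
    interpret hi: ring_hom_ring R "S i" "h i" using i by (rule ring_hom)
    show ?thesis using nil_clean_ring.nil_clean[OF assms[OF i], of "h i a"] a by auto
  qed
  then obtain e' n where e': "\<And>i. i \<in> I \<Longrightarrow> e' i \<in> idempotents (S i)"
    and n: "\<And>i. i \<in> I \<Longrightarrow> n i \<in> nilpotents (S i)"
    and en: "\<And>i. i \<in> I \<Longrightarrow> h i a = e' i \<oplus>\<^bsub>S i\<^esub> n i"
    by metis
  from lift_idempotent[OF e'] obtain e where e: "e \<in> idempotents R"
    and he: "\<And>i. i \<in> I \<Longrightarrow> h i e = e' i" by blast
  have eR: "e \<in> carrier R" using e by (simp add: idempotents_def)
  have "a \<ominus> e \<in> nilpotents R"
  proof (rule lift_nilpotents)
    fix i assume i: "i \<in> I"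
    interpret hi: ring_hom_ring R "S i" "h i" using i by (rule ring_hom)
    have [simp]: "e' i \<in> carrier (S i)" "n i \<in> carrier (S i)"
      using e'[OF i] n[OF i] by (auto simp: idempotents_def nilpotents_def)
    have "e' i \<oplus>\<^bsub>S i\<^esub> n i \<ominus>\<^bsub>S i\<^esub> e' i = n i"
      by (simp add: a_minus_def hi.S.a_comm[of "e' i"] hi.S.a_assoc hi.S.r_neg)
    then show "h i (a \<ominus> e) \<in> nilpotents (S i)"
      using a eR n[OF i] by (simp add: hi.hom_minus he[OF i] en[OF i])
  qed (use a eR in simp)
  moreover have "a = e \<oplus> (a \<ominus> e)" using a eR by algebra
  ultimately show "\<exists>e\<in>idempotents R. \<exists>n\<in>nilpotents R. a = e \<oplus> n" using e by blast
qed

text \<open>A lift \<open>e\<close> of the idempotents agrees with \<open>a x\<close> only modulo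
  the common kernel, so it need not lie in \<open>a R\<close>. Conjugating by a unit congruent to 1
  moves it into \<open>a R\<close> and its complement into \<open>(1 - a) R\<close>.\<close>

lemma exchange_ring_lift:
  assumes "\<And>i. i \<in> I \<Longrightarrow> exchange_ring (S i)"
  shows "exchange_ring R"
proof
  fix a assume a: "a \<in> carrier R"
  have "\<exists>e x y. e \<in> idempotents (S i) \<and> x \<in> carrier (S i) \<and> y \<in> carrier (S i) \<and>
      e = h i a \<otimes>\<^bsub>S i\<^esub> x \<and> \<one>\<^bsub>S i\<^esub> \<ominus>\<^bsub>S i\<^esub> e = (\<one>\<^bsub>S i\<^esub> \<ominus>\<^bsub>S i\<^esub> h i a) \<otimes>\<^bsub>S i\<^esub> y" if i: "i \<in> I" for i
  proof -
    interpret hi: ring_hom_ring R "S i" "h i" using i by (rule ring_hom)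
    show ?thesis using exchange_ring.exchange[OF assms[OF i] hi.hom_closed[OF a]] by blast
  qed
  then obtain e' x' y' where e': "\<And>i. i \<in> I \<Longrightarrow> e' i \<in> idempotents (S i)"
    and x': "\<And>i. i \<in> I \<Longrightarrow> x' i \<in> carrier (S i)" "\<And>i. i \<in> I \<Longrightarrow> h i a \<otimes>\<^bsub>S i\<^esub> x' i = e' i"
    and y': "\<And>i. i \<in> I \<Longrightarrow> y' i \<in> carrier (S i)"
      "\<And>i. i \<in> I \<Longrightarrow> (\<one>\<^bsub>S i\<^esub> \<ominus>\<^bsub>S i\<^esub> h i a) \<otimes>\<^bsub>S i\<^esub> y' i = \<one>\<^bsub>S i\<^esub> \<ominus>\<^bsub>S i\<^esub> e' i"
    by metis
  from lift_idempotent[OF e'] obtain e where e: "e \<in> idempotents R"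
    and he: "\<And>i. i \<in> I \<Longrightarrow> h i e = e' i" by blast
  from lift[OF x'(1)] obtain x where x: "x \<in> carrier R"
    and hx: "\<And>i. i \<in> I \<Longrightarrow> h i x = x' i" by blast
  from lift[OF y'(1)] obtain y where y: "y \<in> carrier R"
    and hy: "\<And>i. i \<in> I \<Longrightarrow> h i y = y' i" by blast
  have eR: "e \<in> carrier R" and ee: "e \<otimes> e = e" using e by (simp_all add: idempotents_def)
  define c where "c = \<one> \<ominus> e"
  have cR: "c \<in> carrier R" unfolding c_def using eR by simp
  have ce: "c \<otimes> e = \<zero>" and ec: "e \<otimes> c = \<zero>"
    unfolding c_def using eR ee by (simp_all add: a_minus_def l_distr r_distr l_minus r_minus r_neg)
  have cc: "c \<otimes> c = c"
  proof -
    have "c \<otimes> c = c \<otimes> (\<one> \<ominus> e)" by (simp add: c_def)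
    also have "\<dots> = c" using cR eR ce by (simp add: a_minus_def r_distr r_minus)
    finally show ?thesis .
  qed
  define p where "p = a \<otimes> x"
  define q where "q = (\<one> \<ominus> a) \<otimes> y"
  have pR: "p \<in> carrier R" and qR: "q \<in> carrier R" using a x y by (auto simp: p_def q_def)
  \<comment> \<open>Modulo the common kernel \<open>p\<close> is \<open>e\<close> and
    \<open>q\<close> is \<open>c\<close>, so \<open>w\<close> becomes \<open>e e + c c = 1\<close>.
    By orthogonality, multiplying \<open>w\<close> on the right by \<open>e\<close> or
    \<open>c\<close> selects one summand.\<close>
  define w where "w = p \<otimes> e \<oplus> q \<otimes> c"
  have wR: "w \<in> carrier R" using pR qR eR cR by (simp add: w_def)
  have w: "w \<in> Units R"
  proof (rule Units_of_eq_one[OF wR])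
    fix i assume i: "i \<in> I"
    interpret hi: ring_hom_ring R "S i" "h i" using i by (rule ring_hom)
    have "h i p = h i e"
      using a x by (simp add: p_def he[OF i] hx[OF i] x'(2)[OF i])
    moreover have "h i q = h i c"
      using a y eR by (simp add: q_def c_def hi.hom_minus he[OF i] hy[OF i] y'(2)[OF i])
    ultimately have "h i w = h i (e \<otimes> e \<oplus> c \<otimes> c)"
      using pR qR eR cR by (simp add: w_def)
    also have "e \<otimes> e \<oplus> c \<otimes> c = \<one>"
      using eR by (simp add: ee cc) (simp add: c_def a_minus_def a_comm[of \<one> "\<ominus> e"] r_neg2)
    finally show "h i w = \<one>\<^bsub>S i\<^esub>" by simp
  qed
  have we: "w \<otimes> e = p \<otimes> e"
    using pR qR eR cR by (simp add: w_def l_distr m_assoc ee ce)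
  have wc: "w \<otimes> c = q \<otimes> c"
    using pR qR eR cR by (simp add: w_def l_distr m_assoc cc ec)
  define v where "v = inv w"
  have vR: "v \<in> carrier R" and wv: "w \<otimes> v = \<one>" and vw: "v \<otimes> w = \<one>"
    using w by (simp_all add: v_def)
  define f where "f = w \<otimes> e \<otimes> v"
  have fR: "f \<in> carrier R" using wR eR vR by (simp add: f_def)
  have "f \<otimes> f = w \<otimes> e \<otimes> (v \<otimes> w) \<otimes> e \<otimes> v"
    using wR eR vR by (simp add: f_def m_assoc)
  also have "\<dots> = w \<otimes> (e \<otimes> e) \<otimes> v"
    using wR eR vR by (simp add: vw m_assoc)
  finally have "f \<in> idempotents R" using fR ee by (simp add: f_def idempotents_def)
  \<comment> \<open>Since \<open>w e = p e\<close>, the factor \<open>a\<close> of \<open>p\<close>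
    comes out on the left.\<close>
  moreover have "f = a \<otimes> (x \<otimes> e \<otimes> v)"
    unfolding f_def we using a x eR vR by (simp add: p_def m_assoc)
  \<comment> \<open>The complement of the conjugate is the conjugate \<open>w c v\<close> of the
    complement, and \<open>w c = q c\<close> begins with the factor \<open>1 - a\<close>.\<close>
  moreover have "\<one> \<ominus> f = (\<one> \<ominus> a) \<otimes> (y \<otimes> c \<otimes> v)"
  proof -
    have "\<one> \<ominus> f = w \<otimes> v \<ominus> w \<otimes> e \<otimes> v" by (simp add: f_def wv)
    also have "\<dots> = w \<otimes> c \<otimes> v"
      using wR eR vR by (simp add: c_def a_minus_def l_distr r_distr l_minus r_minus)
    also have "\<dots> = (\<one> \<ominus> a) \<otimes> (y \<otimes> c \<otimes> v)"
      unfolding wc using a y cR vR by (simp add: q_def m_assoc)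
    finally show ?thesis .
  qed
  ultimately show "\<exists>e\<in>idempotents R. (\<exists>x\<in>carrier R. e = a \<otimes> x) \<and>
      (\<exists>y\<in>carrier R. \<one> \<ominus> e = (\<one> \<ominus> a) \<otimes> y)"
    using m_closed[OF m_closed[OF x eR] vR] m_closed[OF m_closed[OF y cR] vR] by blast
qed

section \<open>Equivalence with the properties of the components\<close>

lemma surj_component:
  assumes "i \<in> I"
  shows "h i ` carrier R = carrier (S i)"
proof
  interpret hi: ring_hom_ring R "S i" "h i" using assms by (rule ring_hom)
  show "h i ` carrier R \<subseteq> carrier (S i)" by auto
  show "carrier (S i) \<subseteq> h i ` carrier R"
  proof
    fix b assume "b \<in> carrier (S i)"
    \<comment> \<open>The family with value \<open>b\<close> at \<open>i\<close> and zero elsewhere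
      lifts to a preimage of \<open>b\<close>.\<close>
    then have "(if j = i then b else \<zero>\<^bsub>S j\<^esub>) \<in> carrier (S j)" if "j \<in> I" for j
      using ring_S[OF that] by (simp add: ring.ring_simprules)
    from lift[OF this] obtain x
      where "x \<in> carrier R" "\<forall>j\<in>I. h j x = (if j = i then b else \<zero>\<^bsub>S j\<^esub>)" by blast
    then show "b \<in> h i ` carrier R" using assms by force
  qed
qed

lemma clean_ring_iff: "clean_ring R \<longleftrightarrow> (\<forall>i\<in>I. clean_ring (S i))"
  using ring_hom surj_component clean_ring_lift ring_hom_ring.surj_clean_ring by blast

lemma nil_clean_ring_iff: "nil_clean_ring R \<longleftrightarrow> (\<forall>i\<in>I. nil_clean_ring (S i))"
  using ring_hom surj_component nil_clean_ring_lift ring_hom_ring.surj_nil_clean_ring by blast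

lemma exchange_ring_iff: "exchange_ring R \<longleftrightarrow> (\<forall>i\<in>I. exchange_ring (S i))"
  using ring_hom surj_component exchange_ring_lift ring_hom_ring.surj_exchange_ring by blast

end

section \<open>The diagonal of a matrix\<close>

context algebra_presheaf
begin

context
  assumes fin: "finite C"
begin

text \<open>By antisymmetry the interval from \<open>i\<close> to \<open>i\<close> is just
  \<open>i\<close>, so the defining sum has one term, and there the map \<open>\<phi> i i\<close> is
  the identity.\<close>

lemma M_mult_diag:
  assumes a: "a \<in> carrier M" and b: "b \<in> carrier M" and i: "i \<in> C"
  shows "(a \<otimes>\<^bsub>M\<^esub> b) (i, i) = a (i, i) \<otimes>\<^bsub>A i\<^esub> b (i, i)"
proof -
  interpret ring "A i" using ring_A i by simp
  have "{s \<in> C. (i, s) \<in> P \<and> (s, i) \<in> P} = {i}"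
    using P_refl[OF i] P_antisym i by auto
  then show ?thesis using a b i by (simp add: M_apply P_refl M_entry map_id)
qed

lemma diag_ring_hom:
  assumes i: "i \<in> C"
  shows "ring_hom_ring M (A i) (\<lambda>a. a (i, i))"
  using i by (intro ring_hom_ringI2 ring_matrix_algebra fin ring_A ring_hom_memI)
    (auto simp: M_entry M_mult_diag M_apply)

text \<open>A section of the diagonal map. By \<open>diag_mult\<close> it respects products, hence
  carries families of idempotents to idempotent matrices.\<close>

definition diag :: "('c \<Rightarrow> 'a) \<Rightarrow> 'c \<times> 'c \<Rightarrow> 'a"
  where "diag y = (\<lambda>(i, j) \<in> C \<times> C. if i = j then y i else \<zero>\<^bsub>A i\<^esub>)"

lemma diag_closed: "(\<And>i. i \<in> C \<Longrightarrow> y i \<in> carrier (A i)) \<Longrightarrow> diag y \<in> carrier M"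
  by (auto simp: carrier_M diag_def P_refl ring_A ring.ring_simprules)

lemma diag_mult:
  assumes y: "\<And>i. i \<in> C \<Longrightarrow> y i \<in> carrier (A i)" and z: "\<And>i. i \<in> C \<Longrightarrow> z i \<in> carrier (A i)"
  shows "diag y \<otimes>\<^bsub>M\<^esub> diag z = diag (\<lambda>i. y i \<otimes>\<^bsub>A i\<^esub> z i)"
proof (rule matrix_algebra_eqI[of _ C])
  fix h j assume h: "h \<in> C" and j: "j \<in> C"
  interpret ring "A h" using ring_A h by simp
  note cl = diag_closed[OF y] diag_closed[OF z]
  show "(diag y \<otimes>\<^bsub>M\<^esub> diag z) (h, j) = diag (\<lambda>i. y i \<otimes>\<^bsub>A i\<^esub> z i) (h, j)"
  proof (cases "h = j")
    case True
    then show ?thesis using M_mult_diag[OF cl] j by (simp add: diag_def)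
  next
    case False
    \<comment> \<open>As \<open>h\<close> and \<open>j\<close> differ, either \<open>i\<close>
      differs from \<open>h\<close> and the left factor vanishes, or \<open>i = h\<close> differs
      from \<open>j\<close> and the right one does.\<close>
    have "diag y (h, i) \<otimes>\<^bsub>A h\<^esub> Phi h i (diag z (i, j)) = \<zero>\<^bsub>A h\<^esub>" if i: "i \<in> C" for i
    proof (cases "h = i")
      case True
      then show ?thesis using h j \<open>h \<noteq> j\<close> r_null[OF y[OF h]] by (simp add: diag_def Phi_zero)
    next
      case False
      then show ?thesis using h i M_entry[OF cl(2) i j] by (simp add: diag_def Phi_closed)
    qed
    then have "(\<Oplus>\<^bsub>A h\<^esub> i \<in> C. diag y (h, i) \<otimes>\<^bsub>A h\<^esub> Phi h i (diag z (i, j))) = (\<Oplus>\<^bsub>A h\<^esub> i \<in> C. \<zero>\<^bsub>A h\<^esub>)"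
      by (intro finsum_cong') auto
    then show ?thesis
      using M_mult_apply[OF fin cl h j] h j False by (simp add: diag_def)
  qed
qed (auto simp: M_extensional diag_def)

text \<open>
  A path of length \<open>m\<close> of strict steps from \<open>h\<close> to \<open>j\<close> passes through \<open>m + 1\<close> elements of the
  interval \<open>[h, j]\<close>.
\<close>

lemma strictly_triangular_pow:
  assumes a: "a \<in> carrier M" and diag0: "\<And>i. i \<in> C \<Longrightarrow> a (i, i) = \<zero>\<^bsub>A i\<^esub>"
    and h: "h \<in> C" and j: "j \<in> C" and m: "card {i. (h, i) \<in> P \<and> (i, j) \<in> P} \<le> m"
  shows "(a [^]\<^bsub>M\<^esub> m) (h, j) = \<zero>\<^bsub>A h\<^esub>"
  using j m
\<comment> \<open>Powers grow by a factor on the right, so the row \<open>h\<close> stays fixed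
  while the column varies.\<close>
proof (induction m arbitrary: j)
  case 0
  \<comment> \<open>A finite set of cardinality 0 is empty, but for \<open>h = j\<close> the
    interval would contain \<open>h\<close>. So the entry lies off the diagonal of the identity
    matrix.\<close>
  have "finite {i. (h, i) \<in> P \<and> (i, j) \<in> P}"
    using P_in by (intro finite_subset[OF _ fin]) auto
  with 0 have "h \<noteq> j" using P_refl h by auto
  then show ?case using h 0 by (simp add: M_apply)
next
  case (Suc m)
  interpret ring "A h" using ring_A h by simp
  interpret M: ring M using fin by (rule ring_matrix_algebra)
  let ?I = "\<lambda>j. {i. (h, i) \<in> P \<and> (i, j) \<in> P}"
  have finI: "finite (?I j)" using P_in by (intro finite_subset[OF _ fin]) auto
  have pow: "a [^]\<^bsub>M\<^esub> m \<in> carrier M" using a by simp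
  have "(a [^]\<^bsub>M\<^esub> m) (h, i) \<otimes>\<^bsub>A h\<^esub> Phi h i (a (i, j)) = \<zero>\<^bsub>A h\<^esub>" if i: "i \<in> C" for i
  proof -
    consider "i = j" | "(h, i) \<notin> P" | "(i, j) \<notin> P" | "i \<noteq> j" "(h, i) \<in> P" "(i, j) \<in> P" by blast
    then show ?thesis
    proof cases
      case 1
      then show ?thesis using diag0[OF i] M_entry[OF pow h i] h by (simp add: Phi_zero)
    next
      case 2
      then show ?thesis using M_entry[OF pow h i] by (simp add: Phi_def)
    next
      case 3
      then show ?thesis using M_zero_entry[OF a i \<open>j \<in> C\<close>] M_entry[OF pow h i] h
        by (simp add: Phi_zero)
    next
      case 4
      \<comment> \<open>The smaller interval misses \<open>j\<close>, so its cardinality is at most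
        \<open>m\<close> and the induction hypothesis applies in column \<open>i\<close>.\<close>
      then have "?I i \<subset> ?I j"
        using P_trans P_antisym P_refl[OF \<open>j \<in> C\<close>] by blast
      then have "card (?I i) < card (?I j)" using finI by (simp add: psubset_card_mono)
      then have "(a [^]\<^bsub>M\<^esub> m) (h, i) = \<zero>\<^bsub>A h\<^esub>" using Suc i by simp
      then show ?thesis using M_entry[OF a i \<open>j \<in> C\<close>] h by (simp add: Phi_closed)
    qed
  qed
  then have "(\<Oplus>\<^bsub>A h\<^esub> i \<in> C. (a [^]\<^bsub>M\<^esub> m) (h, i) \<otimes>\<^bsub>A h\<^esub> Phi h i (a (i, j))) = (\<Oplus>\<^bsub>A h\<^esub> i \<in> C. \<zero>\<^bsub>A h\<^esub>)"
    by (intro finsum_cong') auto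
  then show ?case using M_mult_apply[OF fin pow a h \<open>j \<in> C\<close>] by simp
qed

lemma strictly_triangular_nilpotent:
  assumes a: "a \<in> carrier M" and diag0: "\<And>i. i \<in> C \<Longrightarrow> a (i, i) = \<zero>\<^bsub>A i\<^esub>"
  shows "a \<in> nilpotents M"
proof -
  interpret M: ring M using fin by (rule ring_matrix_algebra)
  \<comment> \<open>Every interval has at most \<open>card C\<close> elements, so this one exponent
    annihilates all entries.\<close>
  have "a [^]\<^bsub>M\<^esub> card C = \<zero>\<^bsub>M\<^esub>"
  proof (rule matrix_algebra_eqI[of _ C])
    fix h j assume h: "h \<in> C" and j: "j \<in> C"
    have "card {i. (h, i) \<in> P \<and> (i, j) \<in> P} \<le> card C"
      using P_in by (intro card_mono fin) auto
    then show "(a [^]\<^bsub>M\<^esub> card C) (h, j) = \<zero>\<^bsub>M\<^esub> (h, j)"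
      using strictly_triangular_pow[OF a diag0 h j] h j by (simp add: M_apply)
  qed (use a in \<open>auto simp: M_extensional\<close>)
  then show ?thesis using a by (auto simp: nilpotents_def)
qed

lemma nil_extension_diag: "nil_extension M C A (\<lambda>i a. a (i, i))"
proof (intro nil_extension.intro nil_extension_axioms.intro)
  fix y assume y: "\<And>i. i \<in> C \<Longrightarrow> y i \<in> carrier (A i)"
  show "\<exists>x\<in>carrier M. \<forall>i\<in>C. x (i, i) = y i"
    using diag_closed[OF y] by (intro bexI[of _ "diag y"]) (auto simp: diag_def)
next
  fix y assume y: "\<And>i. i \<in> C \<Longrightarrow> y i \<in> idempotents (A i)"
  then have cl: "\<And>i. i \<in> C \<Longrightarrow> y i \<in> carrier (A i)" by (simp add: idempotents_def)
  \<comment> \<open>Equality as functions is available because \<open>diag\<close> ignores the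
    values of \<open>y\<close> outside \<open>C\<close>, where nothing is known of them.\<close>
  have "diag (\<lambda>i. y i \<otimes>\<^bsub>A i\<^esub> y i) = diag y"
    using y by (auto simp: diag_def idempotents_def fun_eq_iff)
  then have "diag y \<in> idempotents M"
    using diag_mult[OF cl cl] diag_closed[OF cl] by (simp add: idempotents_def)
  then show "\<exists>x\<in>idempotents M. \<forall>i\<in>C. x (i, i) = y i"
    by (intro bexI[of _ "diag y"]) (auto simp: diag_def)
qed (auto simp: fin ring_matrix_algebra diag_ring_hom strictly_triangular_nilpotent)

end

end

theorem theorem3:
  fixes k :: "('k, 'l) ring_scheme"
    and C :: "'c set" and P :: "('c \<times> 'c) set"
    and A :: "'c \<Rightarrow> ('k, 'a, 'm) module_scheme"
    and \<phi> :: "'c \<Rightarrow> 'c \<Rightarrow> 'a \<Rightarrow> 'a"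
  assumes "finite C"
    and "algebra_presheaf k C P A \<phi>"
  shows "((clean_ring (matrix_algebra C P A \<phi>) \<longleftrightarrow> (\<forall>i\<in>C. clean_ring (A i))) \<and>
          (nil_clean_ring (matrix_algebra C P A \<phi>) \<longleftrightarrow> (\<forall>i\<in>C. nil_clean_ring (A i)))) \<and>
         (exchange_ring (matrix_algebra C P A \<phi>) \<longleftrightarrow> (\<forall>i\<in>C. exchange_ring (A i)))"
proof -
  interpret nil_extension "matrix_algebra C P A \<phi>" C A "\<lambda>i a. a (i, i)"
    using assms by (intro algebra_presheaf.nil_extension_diag)
  show ?thesis using clean_ring_iff nil_clean_ring_iff exchange_ring_iff by blast
qed

end
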